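(* Let $L(\theta\mid\mathbf{y})=f(\mathbf{y};\theta)$ be the full likelihood function, with score function $u(\theta)=u(\theta;\mathbf{y})$ and Fisher information matrix $I(\theta)$. Then, for any composite likelihood function $CL(\theta\mid\mathbf{y})$ with composite score function $u_c(\theta)=u_c(\theta;\mathbf{y})$, sensitivity matrix $H(\theta)$, variability matrix $J(\theta)$ and Godambe information matrix $G(\theta)=H(\theta)J(\theta)^{-1}H(\theta)$, and for every $\theta\in\Theta$, one has $G(\theta)=I(\theta)$ if and only if there is a vector $b(\theta)\in\mathbb{R}^q$, constant with respect to the random vector $\mathbf{y}$, such that $$u(\theta)=H(\theta)J(\theta)^{-1}u_c(\theta)+b(\theta)$$ with probability $1$ (under the distribution of $\mathbf{y}$ with density $f(\cdot\,;\theta)$).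
   Context: Setting: $\mathbf{Y}$ is a $p$-dimensional random vector with probability density function $f(\mathbf{y};\theta)$ (with respect to a fixed dominating measure), where $\theta\in\Theta\subseteq\mathbb{R}^q$ and $\Theta$ is open. All expectations, variances and covariances are taken under $f(\cdot\,;\theta)$ at the same value $\theta$ at which the functions are evaluated; a realization and the random vector itself are both denoted $\mathbf{y}$. Composite likelihood: given likelihood functions $L_k(\theta;\mathbf{y})$, $k=1,\ldots,K$, each defined by the joint (marginal) density of some sub-vector of $\mathbf{Y}$ or the conditional density of some sub-vector of $\mathbf{Y}$ given another, as determined by $f(\cdot\,;\theta)$, and nonnegative weights $w_k$, the composite likelihood function is $CL(\theta\mid\mathbf{y})=\prod_{k=1}^K L_k(\theta;\mathbf{y})^{w_k}$. (A component $L_k$ may depend only on a sub-vector of $\theta$.) Definitions: - Full score: $u(\theta;\mathbf{y})=\nabla_\theta\log f(\mathbf{y};\theta)$; Fisher information: $I(\theta)=\mathrm{Var}_\theta\{u(\theta;\mathbf{y})\}$ ($q\times q$). - Composite score: $u_c(\theta;\mathbf{y})=\nabla_\theta\log CL(\theta\mid\mathbf{y})$. - Sensitivity matrix: $H(\theta)=E_\theta\{-\nabla_\theta u_c(\theta;\mathbf{y})\}$, where $\nabla_\theta u_c$ is the $q\times q$ Hessian matrix of $\log CL$. - Variability matrix: $J(\theta)=\mathrm{Var}_\theta\{u_c(\theta;\mathbf{y})\}$. - Godambe information matrix: $G(\theta)=H(\theta)J(\theta)^{-1}H(\theta)$. Standing regularity conditions: the support of $f(\cdot\,;\theta)$ does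 not depend on $\theta$; $\log f$ and $\log CL$ are twice continuously differentiable in $\theta$; $u$ and $u_c$ have finite second moments and $\nabla_\theta u_c$ has finite expectation; $E_\theta\{u(\theta;\mathbf{y})\}=0$ and $E_\theta\{u_c(\theta;\mathbf{y})\}=0$ for all $\theta\in\Theta$; the identity $\int u_c(\theta;\mathbf{y})f(\mathbf{y};\theta)\,d\mathbf{y}=0$ may be differentiated in $\theta$ under the integral sign (integral with respect to the dominating measure); and $J(\theta)$ is invertible for every $\theta\in\Theta$. *)

theory Defs
  imports "HOL-Probability.Probability"
begin

subsection \<open>Derivatives in the parameter\<close>

definition grad :: "(real^'q \<Rightarrow> real) \<Rightarrow> real^'q \<Rightarrow> real^'q" where
  "grad l \<theta> = (\<chi> i. frechet_derivative l (at \<theta>) (axis i 1))"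

text \<open>The Hessian of \<open>l\<close> is the Jacobian of its gradient.\<close>

definition C2_on :: "(real^'q) set \<Rightarrow> (real^'q \<Rightarrow> real) \<Rightarrow> bool" where
  "C2_on \<Theta> l \<longleftrightarrow>
     (\<forall>\<theta>\<in>\<Theta>. l differentiable (at \<theta>)) \<and>
     (\<forall>\<theta>\<in>\<Theta>. grad l differentiable (at \<theta>)) \<and>
     continuous_on \<Theta> (\<lambda>\<theta>. jacobian (grad l) (at \<theta>))"

subsection \<open>Random vectors\<close>

definition cov_matrix :: "'a measure \<Rightarrow> ('a \<Rightarrow> real^'q) \<Rightarrow> real^'q^'q" where
  "cov_matrix M X = (\<chi> i j. \<integral>y. (X y $ i - (\<integral>z. X z $ i \<partial>M)) * (X y $ j - (\<integral>z. X z $ j \<partial>M)) \<partial>M)"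

definition finite_second_moments :: "'a measure \<Rightarrow> ('a \<Rightarrow> real^'q) \<Rightarrow> bool" where
  "finite_second_moments M X \<longleftrightarrow> X \<in> borel_measurable M \<and> integrable M (\<lambda>y. (norm (X y))\<^sup>2)"

text \<open>The sub-vector of \<open>y\<close> with coordinates in \<open>A\<close>, as an element of the product space
  \<open>subvec_space A\<close>.\<close>

definition subvec :: "'p set \<Rightarrow> real^'p \<Rightarrow> 'p \<Rightarrow> real" where
  "subvec A y = restrict (\<lambda>i. y $ i) A"

definition subvec_space :: "'p set \<Rightarrow> ('p \<Rightarrow> real) measure" where
  "subvec_space A = PiM A (\<lambda>_. borel)"

text \<open>A law on \<open>real^'p\<close> need not have product form, nor need its dominating measure; hence
  densities of sub-vectors are taken with respect to arbitrary reference measures (which will not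
  be allowed to depend on the parameter). For a conditional density the reference measure
  \<open>\<kappa> b\<close> may depend on the conditioning value \<open>b\<close>.\<close>

definition marginal_density ::
  "(real^'p) measure \<Rightarrow> 'p set \<Rightarrow> ('p \<Rightarrow> real) measure \<Rightarrow> (('p \<Rightarrow> real) \<Rightarrow> real) \<Rightarrow> bool" where
  "marginal_density P A \<nu> g \<longleftrightarrow>
     sets \<nu> = sets (subvec_space A) \<and> (\<forall>a. 0 \<le> g a) \<and>
     distributed P \<nu> (subvec A) (\<lambda>a. ennreal (g a))"

text \<open>\<open>g (a, b)\<close> is the density at \<open>a\<close> of the sub-vector \<open>A\<close> given that the sub-vector \<open>B\<close>
  equals \<open>b\<close>, that is,
  \<open>P (Y\<^sub>A \<in> S, Y\<^sub>B \<in> T) = E (1\<^sub>T(Y\<^sub>B) \<integral>\<^sub>S g (a, Y\<^sub>B) \<kappa>(Y\<^sub>B, da))\<close>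
  for all measurable \<open>S\<close> and \<open>T\<close>.\<close>

definition conditional_density ::
  "(real^'p) measure \<Rightarrow> 'p set \<Rightarrow> 'p set \<Rightarrow> (('p \<Rightarrow> real) \<Rightarrow> ('p \<Rightarrow> real) measure)
    \<Rightarrow> (('p \<Rightarrow> real) \<times> ('p \<Rightarrow> real) \<Rightarrow> real) \<Rightarrow> bool" where
  "conditional_density P A B \<kappa> g \<longleftrightarrow>
     (\<forall>b. sets (\<kappa> b) = sets (subvec_space A)) \<and> (\<forall>z. 0 \<le> g z) \<and>
     g \<in> borel_measurable (subvec_space A \<Otimes>\<^sub>M subvec_space B) \<and>
     (\<forall>S\<in>sets (subvec_space A).
        (\<lambda>b. \<integral>\<^sup>+a\<in>S. ennreal (g (a, b)) \<partial>\<kappa> b) \<in> borel_measurable (subvec_space B) \<and>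
        (\<forall>T\<in>sets (subvec_space B).
           emeasure P {y \<in> space P. subvec A y \<in> S \<and> subvec B y \<in> T} =
           (\<integral>\<^sup>+y\<in>{y. subvec B y \<in> T}.
              (\<integral>\<^sup>+a\<in>S. ennreal (g (a, subvec B y)) \<partial>\<kappa> (subvec B y)) \<partial>P)))"

subsection \<open>Likelihoods\<close>

definition law :: "(real^'p) measure \<Rightarrow> (real^'q \<Rightarrow> real^'p \<Rightarrow> real) \<Rightarrow> real^'q \<Rightarrow> (real^'p) measure" where
  "law \<mu> f \<theta> = density \<mu> (\<lambda>y. ennreal (f \<theta> y))"

definition component_likelihood ::
  "(real^'p) measure \<Rightarrow> (real^'q \<Rightarrow> real^'p \<Rightarrow> real) \<Rightarrow> (real^'q) set
    \<Rightarrow> (real^'q \<Rightarrow> real^'p \<Rightarrow> real) \<Rightarrow> bool" where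
  "component_likelihood \<mu> f \<Theta> L \<longleftrightarrow>
     (\<exists>A \<nu> g. \<forall>\<theta>\<in>\<Theta>. marginal_density (law \<mu> f \<theta>) A \<nu> (g \<theta>) \<and>
        (\<forall>y. L \<theta> y = g \<theta> (subvec A y))) \<or>
     (\<exists>A B \<kappa> g. \<forall>\<theta>\<in>\<Theta>. conditional_density (law \<mu> f \<theta>) A B \<kappa> (g \<theta>) \<and>
        (\<forall>y. L \<theta> y = g \<theta> (subvec A y, subvec B y)))"

text \<open>The case distinction makes \<open>0\<close> to the power \<open>0\<close> equal to \<open>1\<close>, whereas \<open>0 powr 0 = 0\<close>.\<close>

definition composite_likelihood ::
  "nat \<Rightarrow> (nat \<Rightarrow> real) \<Rightarrow> (nat \<Rightarrow> real^'q \<Rightarrow> real^'p \<Rightarrow> real) \<Rightarrow> real^'q \<Rightarrow> real^'p \<Rightarrow> real" where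
  "composite_likelihood K w L \<theta> y = (\<Prod>k=1..K. if w k = 0 then 1 else L k \<theta> y powr w k)"

definition score :: "(real^'q \<Rightarrow> real^'p \<Rightarrow> real) \<Rightarrow> real^'q \<Rightarrow> real^'p \<Rightarrow> real^'q" where
  "score l \<theta> y = grad (\<lambda>t. ln (l t y)) \<theta>"

subsection \<open>Information matrices\<close>

text \<open>Here \<open>P\<close> is the family of laws, and \<open>l\<close> is the full or composite likelihood.\<close>

definition fisher_information ::
  "(real^'q \<Rightarrow> (real^'p) measure) \<Rightarrow> (real^'q \<Rightarrow> real^'p \<Rightarrow> real) \<Rightarrow> real^'q \<Rightarrow> real^'q^'q" where
  "fisher_information P l \<theta> = cov_matrix (P \<theta>) (score l \<theta>)"

definition sensitivity_matrix ::
  "(real^'q \<Rightarrow> (real^'p) measure) \<Rightarrow> (real^'q \<Rightarrow> real^'p \<Rightarrow> real) \<Rightarrow> real^'q \<Rightarrow> real^'q^'q" where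
  "sensitivity_matrix P l \<theta> = (\<integral>y. - jacobian (\<lambda>t. score l t y) (at \<theta>) \<partial>P \<theta>)"

definition variability_matrix ::
  "(real^'q \<Rightarrow> (real^'p) measure) \<Rightarrow> (real^'q \<Rightarrow> real^'p \<Rightarrow> real) \<Rightarrow> real^'q \<Rightarrow> real^'q^'q" where
  "variability_matrix P l \<theta> = cov_matrix (P \<theta>) (score l \<theta>)"

definition godambe_information ::
  "(real^'q \<Rightarrow> (real^'p) measure) \<Rightarrow> (real^'q \<Rightarrow> real^'p \<Rightarrow> real) \<Rightarrow> real^'q \<Rightarrow> real^'q^'q" where
  "godambe_information P l \<theta> =
     sensitivity_matrix P l \<theta> ** matrix_inv (variability_matrix P l \<theta>) ** sensitivity_matrix P l \<theta>"

end

theory Submission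
  imports Defs
begin

text \<open>Write \<open>E\<close> for the expectation under \<open>\<theta>\<close>. Differentiating \<open>\<integral> u\<^sub>c f = 0\<close> under the integral
  sign gives the cross moment \<open>E (u\<^sub>c u\<^sup>T) = H\<close>. As \<open>H\<close> is a mean of Hessians it is symmetric, so
  with \<open>W = H J\<^sup>-\<^sup>1\<close> the cross moment of \<open>u\<close> and \<open>W u\<^sub>c\<close> and the second moment of \<open>W u\<^sub>c\<close> both equal
  \<open>G\<close>. Hence the second moment of the residual \<open>Z = u - W u\<^sub>c\<close> is \<open>I - G\<close>, which vanishes iff
  \<open>Z = 0\<close> almost surely; as \<open>Z\<close> has mean zero, a constant \<open>Z\<close> is zero.\<close>

subsection \<open>Gradients and the symmetry of the Hessian\<close>

lemma frechet_derivative_eq_grad: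
  fixes l :: "real^'q \<Rightarrow> real"
  assumes "l differentiable (at x)"
  shows "frechet_derivative l (at x) = (\<lambda>h. grad l x \<bullet> h)"
proof
  fix h :: "real^'q"
  have lin: "linear (frechet_derivative l (at x))"
    using assms by (rule linear_frechet_derivative)
  have "frechet_derivative l (at x) h = frechet_derivative l (at x) (\<Sum>i\<in>UNIV. h $ i *\<^sub>R axis i 1)"
    using basis_expansion[of h] by (simp add: scalar_mult_eq_scaleR)
  also have "\<dots> = (\<Sum>i\<in>UNIV. h $ i * frechet_derivative l (at x) (axis i 1))"
    by (simp add: linear_sum[OF lin] linear_scale[OF lin])
  also have "\<dots> = grad l x \<bullet> h"
    by (simp add: grad_def inner_vec_def mult.commute)
  finally show "frechet_derivative l (at x) h = grad l x \<bullet> h" .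
qed

lemma has_derivative_grad:
  fixes l :: "real^'q \<Rightarrow> real"
  assumes "l differentiable (at x)"
  shows "(l has_derivative (\<lambda>h. grad l x \<bullet> h)) (at x)"
  using assms frechet_derivative_works frechet_derivative_eq_grad[OF assms] by metis

text \<open>The mean value theorem, applied along \<open>v\<close> to the increment of
  \<open>l\<close> by \<open>t w\<close>, turns the second difference into \<open>t\<close> times
  the change of \<open>g\<close> between two points that differ by \<open>t w\<close>, paired with
  \<open>v\<close>. Linearizing \<open>g\<close> at \<open>x\<close> makes this change
  \<open>t D w\<close> up to an error small compared with \<open>t\<close>.\<close>

lemma second_difference_tendsto:
  fixes l :: "'a::real_inner \<Rightarrow> real"
  assumes "open S" "x \<in> S"
    and l: "\<And>y. y \<in> S \<Longrightarrow> (l has_derivative (\<lambda>h. g y \<bullet> h)) (at y)"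
    and g: "(g has_derivative D) (at x)"
  shows "((\<lambda>t. (l (x + t *\<^sub>R v + t *\<^sub>R w) - l (x + t *\<^sub>R v) - l (x + t *\<^sub>R w) + l x) / t\<^sup>2)
           \<longlongrightarrow> D w \<bullet> v) (at_right 0)"
proof (rule tendstoI)
  fix \<epsilon> :: real
  assume "\<epsilon> > 0"
  \<comment> \<open>\<open>C\<close> exceeds the coefficient of \<open>e\<close> in the final error
    estimate; the summand 1 makes it positive and that estimate strict.\<close>
  define C where "C = (2 * norm v + norm w) * norm v + 1"
  have "C > 0" by (simp add: C_def add_nonneg_pos)
  define e where "e = \<epsilon> / C"
  have "e > 0" using \<open>\<epsilon> > 0\<close> \<open>C > 0\<close> by (simp add: e_def)
  interpret D: bounded_linear D using g by (rule has_derivative_bounded_linear)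
  obtain r where r: "r > 0" "ball x r \<subseteq> S"
    using assms(1,2) by (meson openE)
  obtain d where d: "d > 0"
    "\<And>y. norm (y - x) < d \<Longrightarrow> norm (g y - g x - D (y - x)) \<le> e * norm (y - x)"
    using g \<open>e > 0\<close> unfolding has_derivative_at_alt by blast
  \<comment> \<open>Since \<open>t B < min r d\<close> for \<open>0 < t < \<delta>\<close>, every
    point \<open>x + s v + c w\<close> with \<open>s\<close>, \<open>c\<close> between 0 and
    \<open>t\<close> lies in \<open>S\<close> and within the range where the linearization of
    \<open>g\<close> is accurate up to \<open>e\<close>.\<close>
  define B where "B = norm v + norm w + 1"
  have "B > 0" by (simp add: B_def add_nonneg_pos)
  define \<delta> where "\<delta> = min r d / B"
  have "\<delta> > 0" using r(1) d(1) \<open>B > 0\<close> by (simp add: \<delta>_def)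
  have "\<bar>(l (x + t *\<^sub>R v + t *\<^sub>R w) - l (x + t *\<^sub>R v) - l (x + t *\<^sub>R w) + l x) / t\<^sup>2 - D w \<bullet> v\<bar> < \<epsilon>"
    if t: "0 < t" "t < \<delta>" for t
  proof -
    define R where "R h = g (x + h) - g x - D h" for h
    have tB: "t * B < min r d"
      using t \<open>B > 0\<close> by (simp add: \<delta>_def field_simps)
    have small: "norm (s *\<^sub>R v + c *\<^sub>R w) \<le> t * (norm v + norm w)" "norm (s *\<^sub>R v + c *\<^sub>R w) < min r d"
      if "0 \<le> s" "s \<le> t" "0 \<le> c" "c \<le> t" for s c
    proof -
      have "norm (s *\<^sub>R v + c *\<^sub>R w) \<le> s * norm v + c * norm w"
        using norm_triangle_ineq[of "s *\<^sub>R v" "c *\<^sub>R w"] that by simp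
      also have "\<dots> \<le> t * norm v + t * norm w"
        using that by (intro add_mono mult_right_mono) auto
      finally show 1: "norm (s *\<^sub>R v + c *\<^sub>R w) \<le> t * (norm v + norm w)"
        by (simp add: algebra_simps)
      also have "\<dots> < t * B" using t by (simp add: B_def)
      finally show "norm (s *\<^sub>R v + c *\<^sub>R w) < min r d" using tB by simp
    qed
    have inS: "x + s *\<^sub>R v + c *\<^sub>R w \<in> S" if "0 \<le> s" "s \<le> t" "0 \<le> c" "c \<le> t" for s c
      using small(2)[OF that] r(2) by (auto simp: subset_iff dist_norm norm_minus_commute algebra_simps)
    \<comment> \<open>The second difference is \<open>\<phi> t - \<phi> 0\<close>.\<close>
    define \<phi> where "\<phi> s = l (x + s *\<^sub>R v + t *\<^sub>R w) - l (x + s *\<^sub>R v)" for s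
    define \<phi>' where "\<phi>' s = (\<lambda>h. (g (x + s *\<^sub>R v + t *\<^sub>R w) - g (x + s *\<^sub>R v)) \<bullet> (h *\<^sub>R v))" for s
    have der: "(\<phi> has_derivative \<phi>' s) (at s)" if "0 \<le> s" "s \<le> t" for s
    proof -
      \<comment> \<open>The offsets \<open>c = t\<close> and \<open>c = 0\<close> give the two terms
        of \<open>\<phi>\<close>.\<close>
      have 1: "((\<lambda>s. l (x + s *\<^sub>R v + c *\<^sub>R w)) has_derivative (\<lambda>h. g (x + s *\<^sub>R v + c *\<^sub>R w) \<bullet> (h *\<^sub>R v))) (at s)"
        if c: "0 \<le> c" "c \<le> t" for c
        by (rule has_derivative_compose[where f = "\<lambda>s. x + s *\<^sub>R v + c *\<^sub>R w", OF _ l[OF inS[OF \<open>0 \<le> s\<close> \<open>s \<le> t\<close> c]]])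
          (auto intro!: derivative_eq_intros)
      show ?thesis
        using has_derivative_diff[OF 1[of t] 1[of 0]] t
        by (simp add: \<phi>_def[abs_def] \<phi>'_def inner_diff_left right_diff_distrib)
    qed
    have "\<exists>\<xi>\<in>{0<..<t}. \<phi> t - \<phi> 0 = \<phi>' \<xi> (t - 0)"
      using t der by (intro mvt_simple) (auto intro: has_derivative_at_withinI)
    then obtain \<xi> where \<xi>: "0 < \<xi>" "\<xi> < t" "\<phi> t - \<phi> 0 = \<phi>' \<xi> t"
      by auto
    have Rle: "norm (R (s *\<^sub>R v + c *\<^sub>R w)) \<le> e * (s * norm v + c * norm w)"
      if "0 \<le> s" "s \<le> t" "0 \<le> c" "c \<le> t" for s c
    proof -
      have "norm (R (s *\<^sub>R v + c *\<^sub>R w)) \<le> e * norm (s *\<^sub>R v + c *\<^sub>R w)"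
        using d(2)[of "x + (s *\<^sub>R v + c *\<^sub>R w)"] small(2)[OF that] by (simp add: R_def)
      also have "\<dots> \<le> e * (s * norm v + c * norm w)"
        using norm_triangle_ineq[of "s *\<^sub>R v" "c *\<^sub>R w"] that \<open>e > 0\<close> by simp
      finally show ?thesis .
    qed
    \<comment> \<open>Both values of \<open>g\<close> are compared with \<open>g x\<close>; the
      linear parts differ by \<open>D (t w)\<close>, and \<open>\<rho>\<close> collects the two
      remainders.\<close>
    define \<rho> where "\<rho> = R (\<xi> *\<^sub>R v + t *\<^sub>R w) - R (\<xi> *\<^sub>R v)"
    have "norm \<rho> \<le> norm (R (\<xi> *\<^sub>R v + t *\<^sub>R w)) + norm (R (\<xi> *\<^sub>R v))"
      unfolding \<rho>_def by (rule norm_triangle_ineq4)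
    also have "\<dots> \<le> e * (\<xi> * norm v + t * norm w) + e * (\<xi> * norm v)"
      using Rle[of \<xi> t] Rle[of \<xi> 0] \<xi> t by simp
    also have "\<dots> \<le> e * (t * norm v + t * norm w) + e * (t * norm v)"
      using \<xi> \<open>e > 0\<close> by (intro add_mono mult_left_mono mult_right_mono) auto
    finally have \<rho>: "norm \<rho> \<le> t * (e * (2 * norm v + norm w))"
      by (simp add: algebra_simps)
    have "g (x + \<xi> *\<^sub>R v + t *\<^sub>R w) - g (x + \<xi> *\<^sub>R v) = t *\<^sub>R D w + \<rho>"
      by (simp add: \<rho>_def R_def D.add D.scaleR algebra_simps)
    then have "\<phi> t - \<phi> 0 = t\<^sup>2 * (D w \<bullet> v) + t * (\<rho> \<bullet> v)"
      using \<xi>(3) by (simp add: \<phi>'_def power2_eq_square algebra_simps)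
    then have eq: "(l (x + t *\<^sub>R v + t *\<^sub>R w) - l (x + t *\<^sub>R v) - l (x + t *\<^sub>R w) + l x) / t\<^sup>2 - D w \<bullet> v
        = (\<rho> \<bullet> v) / t"
      using t by (simp add: \<phi>_def field_simps power2_eq_square)
    have "\<bar>\<rho> \<bullet> v\<bar> \<le> norm \<rho> * norm v" by (rule Cauchy_Schwarz_ineq2)
    also have "\<dots> \<le> t * (e * (2 * norm v + norm w)) * norm v"
      using \<rho> by (rule mult_right_mono) simp
    also have "\<dots> < t * (e * C)"
      using t \<open>e > 0\<close> by (simp add: C_def algebra_simps)
    also have "e * C = \<epsilon>" using \<open>C > 0\<close> by (simp add: e_def)
    finally show ?thesis using t by (simp add: eq pos_divide_less_eq mult.commute)
  qed
  then show "\<forall>\<^sub>F t in at_right 0. dist ((l (x + t *\<^sub>R v + t *\<^sub>R w) - l (x + t *\<^sub>R v)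
      - l (x + t *\<^sub>R w) + l x) / t\<^sup>2) (D w \<bullet> v) < \<epsilon>"
    using \<open>\<delta> > 0\<close> unfolding eventually_at_right_field dist_real_def by auto
qed

text \<open>Exchanging \<open>v\<close> and \<open>w\<close> leaves the second difference unchanged,
  so both sides are limits of the same quotient.\<close>

lemma symmetric_second_derivative:
  fixes l :: "'a::real_inner \<Rightarrow> real"
  assumes "open S" "x \<in> S"
    and "\<And>y. y \<in> S \<Longrightarrow> (l has_derivative (\<lambda>h. g y \<bullet> h)) (at y)"
    and "(g has_derivative D) (at x)"
  shows "D w \<bullet> v = D v \<bullet> w"
proof (rule tendsto_unique)
  show "((\<lambda>t. (l (x + t *\<^sub>R v + t *\<^sub>R w) - l (x + t *\<^sub>R v) - l (x + t *\<^sub>R w) + l x) / t\<^sup>2)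
           \<longlongrightarrow> D w \<bullet> v) (at_right 0)"
    using assms by (rule second_difference_tendsto)
  show "((\<lambda>t. (l (x + t *\<^sub>R v + t *\<^sub>R w) - l (x + t *\<^sub>R v) - l (x + t *\<^sub>R w) + l x) / t\<^sup>2)
           \<longlongrightarrow> D v \<bullet> w) (at_right 0)"
    using second_difference_tendsto[OF assms, of w v] by (simp add: algebra_simps)
qed simp

lemma transpose_jacobian_grad:
  fixes l :: "real^'q \<Rightarrow> real"
  assumes "open \<Theta>" "\<theta> \<in> \<Theta>" "C2_on \<Theta> l"
  shows "transpose (jacobian (grad l) (at \<theta>)) = jacobian (grad l) (at \<theta>)"
proof -
  define A where "A = jacobian (grad l) (at \<theta>)"
  have "(grad l has_derivative (\<lambda>h. A *v h)) (at \<theta>)"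
    using assms unfolding A_def C2_on_def by (simp add: jacobian_works)
  then have "(A *v w) \<bullet> v = (A *v v) \<bullet> w" for v w
    using assms
    by (intro symmetric_second_derivative[of \<Theta> \<theta> l "grad l"]) (auto simp: C2_on_def intro: has_derivative_grad)
  \<comment> \<open>Pairing with standard basis vectors reads off single entries of
    \<open>A\<close>.\<close>
  from this[of "axis _ 1" "axis _ 1"] have "A $ i $ j = A $ j $ i" for i j
    by (simp add: inner_axis matrix_vector_mul_component inner_commute[of "axis _ _"])
  then show ?thesis by (simp add: A_def[symmetric] transpose_def vec_eq_iff)
qed

subsection \<open>Second moments of random vectors\<close>

text \<open>In matrix notation this is \<open>a b^T\<close>; expectations of such products are
  second and cross moment matrices.\<close>

definition outer :: "real^'m \<Rightarrow> real^'n \<Rightarrow> real^'n^'m" where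
  "outer a b = (\<chi> i j. a $ i * b $ j)"

lemma outer_nth [simp]: "outer a b $ i $ j = a $ i * b $ j"
  by (simp add: outer_def)

lemma outer_mult_vec: "outer a b *v h = (b \<bullet> h) *\<^sub>R a"
  by (simp add: vec_eq_iff matrix_vector_mult_def inner_vec_def sum_distrib_left sum_distrib_right mult_ac)

lemma outer_matrix_left: "outer (A *v a) b = A ** outer a b"
  by (simp add: vec_eq_iff matrix_vector_mult_def matrix_matrix_mult_def sum_distrib_left sum_distrib_right mult_ac)

lemma transpose_outer: "transpose (outer a b) = outer b a"
  by (simp add: vec_eq_iff transpose_def)

lemma outer_matrix_right: "outer a (A *v b) = outer a b ** transpose A"
  by (metis outer_matrix_left transpose_outer matrix_transpose_mul)

lemma outer_diff_diff: "outer (a - b) (a - b) = outer a a - outer a b - outer b a + outer b b"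
  by (simp add: vec_eq_iff algebra_simps)

section \<open>Bounded linear maps to be moved through integrals\<close>

lemma bounded_linear_transpose: "bounded_linear (transpose :: real^'n^'m \<Rightarrow> real^'m^'n)"
  by (rule linear_conv_bounded_linear[THEN iffD1], rule linearI) (auto simp: transpose_def vec_eq_iff)

lemma bounded_linear_matrix_mult_right: "bounded_linear (\<lambda>B :: real^'n^'k. (A :: real^'k^'m) ** B)"
  by (rule linear_conv_bounded_linear[THEN iffD1], rule linearI)
    (auto simp: matrix_matrix_mult_def vec_eq_iff sum.distrib sum_distrib_left algebra_simps)

lemma bounded_linear_matrix_mult_left: "bounded_linear (\<lambda>B :: real^'k^'m. B ** (A :: real^'n^'k))"
  by (rule linear_conv_bounded_linear[THEN iffD1], rule linearI)
    (auto simp: matrix_matrix_mult_def vec_eq_iff sum.distrib sum_distrib_left algebra_simps)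

lemma bounded_linear_axis: "bounded_linear (axis i :: 'b::euclidean_space \<Rightarrow> 'b^'n)"
  by (rule linear_conv_bounded_linear[THEN iffD1], rule linearI) (auto simp: axis_def vec_eq_iff)

text \<open>A vector is the sum of its coordinates placed on the axes. Coordinates may lie in any
  Euclidean space so that matrices are covered: two applications reduce them to their
  entries.\<close>

lemma integrable_vecI:
  fixes X :: "'a \<Rightarrow> 'b::euclidean_space^'n"
  assumes "\<And>i. integrable M (\<lambda>x. X x $ i)"
  shows "integrable M X"
proof -
  have "integrable M (\<lambda>x. \<Sum>i\<in>UNIV. axis i (X x $ i))"
    using assms by (intro Bochner_Integration.integrable_sum integrable_bounded_linear[OF bounded_linear_axis])
  also have "(\<lambda>x. \<Sum>i\<in>UNIV. axis i (X x $ i)) = X"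
    by (auto simp: fun_eq_iff vec_eq_iff axis_def)
  finally show ?thesis .
qed

lemma integral_vec_nth:
  fixes X :: "'a \<Rightarrow> 'b::euclidean_space^'n"
  assumes "integrable M X"
  shows "(\<integral>x. X x $ i \<partial>M) = (\<integral>x. X x \<partial>M) $ i"
  using assms by (rule integral_bounded_linear[OF bounded_linear_vec_nth])

text \<open>Constants are integrable on a probability space, so
  \<open>1 + (norm (X y))\<^sup>2\<close> is an integrable bound for
  \<open>norm (X y)\<close>.\<close>

lemma finite_second_moments_integrable:
  fixes X :: "'a \<Rightarrow> real^'q"
  assumes "prob_space M" "finite_second_moments M X"
  shows "integrable M X"
proof -
  interpret prob_space M by fact
  have "integrable M (\<lambda>y. 1 + (norm (X y))\<^sup>2)" and [measurable]: "X \<in> borel_measurable M"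
    using assms(2) by (auto simp: finite_second_moments_def)
  then show ?thesis
  proof (rule Bochner_Integration.integrable_bound)
    have "norm a \<le> 1 + (norm a)\<^sup>2" for a :: "real^'q"
      using sum_squares_bound[of "norm a" 1] norm_ge_zero[of a] by (simp del: norm_ge_zero)
    then show "AE y in M. norm (X y) \<le> norm (1 + (norm (X y))\<^sup>2)" by simp
  qed
qed

lemma borel_measurable_vec_nth:
  fixes X :: "'a \<Rightarrow> real^'n"
  assumes "X \<in> borel_measurable M"
  shows "(\<lambda>y. X y $ i) \<in> borel_measurable M"
  by (rule measurable_compose[OF assms borel_measurable_continuous_onI])
    (intro continuous_on_component continuous_on_id)

text \<open>Each entry is bounded by the product of the two norms, hence by the sum of their
  squares.\<close>

lemma integrable_outer:
  fixes X :: "'a \<Rightarrow> real^'m" and Y :: "'a \<Rightarrow> real^'n"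
  assumes "finite_second_moments M X" "finite_second_moments M Y"
  shows "integrable M (\<lambda>y. outer (X y) (Y y))"
proof (intro integrable_vecI)
  fix i j
  have [measurable]: "X \<in> borel_measurable M" "Y \<in> borel_measurable M"
    and int: "integrable M (\<lambda>y. (norm (X y))\<^sup>2 + (norm (Y y))\<^sup>2)"
    using assms by (auto simp: finite_second_moments_def)
  have [measurable]: "(\<lambda>y. X y $ i) \<in> borel_measurable M" "(\<lambda>y. Y y $ j) \<in> borel_measurable M"
    by (auto intro: borel_measurable_vec_nth)
  have bound: "\<bar>a $ i * b $ j\<bar> \<le> (norm a)\<^sup>2 + (norm b)\<^sup>2" for a :: "real^'m" and b :: "real^'n"
  proof -
    have "\<bar>a $ i * b $ j\<bar> \<le> norm a * norm b"
      unfolding abs_mult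
      by (rule mult_mono[OF component_le_norm_cart component_le_norm_cart norm_ge_zero abs_ge_zero])
    also have "\<dots> \<le> 2 * norm a * norm b" by simp
    also have "\<dots> \<le> (norm a)\<^sup>2 + (norm b)\<^sup>2" by (rule sum_squares_bound)
    finally show ?thesis .
  qed
  show "integrable M (\<lambda>y. outer (X y) (Y y) $ i $ j)"
    using int by (rule Bochner_Integration.integrable_bound) (simp_all add: bound)
qed

text \<open>Centring at mean zero changes nothing, so the covariance becomes one matrix-valued
  integral to which linear maps can be applied.\<close>

lemma cov_matrix_eq_integral_outer:
  assumes "finite_second_moments M X" "(\<integral>y. X y \<partial>M) = 0" "integrable M X"
  shows "cov_matrix M X = (\<integral>y. outer (X y) (X y) \<partial>M)"
proof -
  have int: "integrable M (\<lambda>y. outer (X y) (X y))"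
    using assms(1) by (intro integrable_outer)
  have "(\<integral>y. X y $ i * X y $ j \<partial>M) = (\<integral>y. outer (X y) (X y) \<partial>M) $ i $ j" for i j
    using integral_vec_nth[OF integrable_bounded_linear[OF bounded_linear_vec_nth int], of i j]
    by (simp add: integral_vec_nth[OF int])
  then show ?thesis
    by (simp add: cov_matrix_def vec_eq_iff integral_vec_nth[OF assms(3)] assms(2))
qed

text \<open>The diagonal of the moment matrix holds the integrals of the squared coordinates; if
  these vanish, so does each of the finitely many coordinates almost everywhere.\<close>

lemma AE_eq_0_iff_integral_outer:
  fixes Z :: "'a \<Rightarrow> real^'q"
  assumes int: "integrable M (\<lambda>y. outer (Z y) (Z y))"
  shows "(AE y in M. Z y = 0) \<longleftrightarrow> (\<integral>y. outer (Z y) (Z y) \<partial>M) = 0"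
proof
  assume "AE y in M. Z y = 0"
  then have "AE y in M. outer (Z y) (Z y) = 0"
    by eventually_elim (simp add: vec_eq_iff)
  then show "(\<integral>y. outer (Z y) (Z y) \<partial>M) = 0"
    by (rule integral_eq_zero_AE)
next
  assume 0: "(\<integral>y. outer (Z y) (Z y) \<partial>M) = 0"
  have "AE y in M. Z y $ i = 0" for i
  proof -
    have int_i: "integrable M (\<lambda>y. outer (Z y) (Z y) $ i)"
      by (rule integrable_bounded_linear[OF bounded_linear_vec_nth int])
    then have int_ii: "integrable M (\<lambda>y. outer (Z y) (Z y) $ i $ i)"
      by (rule integrable_bounded_linear[OF bounded_linear_vec_nth])
    have "(\<integral>y. outer (Z y) (Z y) $ i $ i \<partial>M) = 0"
      by (simp only: integral_vec_nth[OF int_i] integral_vec_nth[OF int] 0) simp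
    then have "AE y in M. outer (Z y) (Z y) $ i $ i = 0"
      using integral_nonneg_eq_0_iff_AE[OF int_ii] by simp
    then show ?thesis by simp
  qed
  then have "AE y in M. \<forall>i. Z y $ i = 0"
    by (simp add: eventually_all_finite)
  then show "AE y in M. Z y = 0"
    by (simp add: vec_eq_iff)
qed

text \<open>Every term in the expansion of the outer product is a fixed linear image of
  \<open>outer (X y) (X y)\<close>, \<open>outer (Y y) (X y)\<close> or
  \<open>outer (Y y) (Y y)\<close>. The two mixed terms are transposes of each other, so
  \<open>C\<close> accounts for both.\<close>

lemma integral_outer_residual:
  fixes X :: "'a \<Rightarrow> real^'m" and Y :: "'a \<Rightarrow> real^'n" and W :: "real^'n^'m"
  assumes X: "finite_second_moments M X" and Y: "finite_second_moments M Y"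
  defines "Z \<equiv> \<lambda>y. X y - W *v Y y"
  defines "C \<equiv> \<integral>y. outer (Y y) (X y) \<partial>M"
  shows "integrable M (\<lambda>y. outer (Z y) (Z y))" (is ?int)
    and "(\<integral>y. outer (Z y) (Z y) \<partial>M) = (\<integral>y. outer (X y) (X y) \<partial>M) - transpose (W ** C) - W ** C
           + W ** (\<integral>y. outer (Y y) (Y y) \<partial>M) ** transpose W" (is ?eq)
proof -
  note WL = bounded_linear_matrix_mult_right[of W]
  note WR = bounded_linear_matrix_mult_left[of "transpose W"]
  note WLT = bounded_linear_compose[OF bounded_linear_transpose WL]
  note WLR = bounded_linear_compose[OF WR WL]
  note YX = integrable_outer[OF Y X] and XX = integrable_outer[OF X X] and YY = integrable_outer[OF Y Y]
  have Z: "outer (Z y) (Z y) = outer (X y) (X y) - transpose (W ** outer (Y y) (X y)) - W ** outer (Y y) (X y)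
      + W ** outer (Y y) (Y y) ** transpose W" for y
    by (simp add: Z_def outer_diff_diff outer_matrix_left outer_matrix_right matrix_transpose_mul
        transpose_outer matrix_mul_assoc)
  note ints = XX integrable_bounded_linear[OF WL YX] integrable_bounded_linear[OF WLT YX]
    integrable_bounded_linear[OF WLR YY]
  show ?int unfolding Z using ints by simp
  show ?eq unfolding Z C_def
    using ints by (simp add: integral_bounded_linear[OF WL YX] integral_bounded_linear[OF WLT YX]
      integral_bounded_linear[OF WLR YY])
qed

section \<open>Symmetric matrices and their inverses\<close>

lemma transpose_cov_matrix: "transpose (cov_matrix M X) = cov_matrix M X"
  by (simp add: transpose_def cov_matrix_def mult.commute)

lemma matrix_inv_works:
  assumes "invertible A"
  shows matrix_inv_right: "A ** matrix_inv A = mat 1" and matrix_inv_left: "matrix_inv A ** A = mat 1"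
  using someI_ex[OF assms[unfolded invertible_def]] by (auto simp: matrix_inv_def)

text \<open>By symmetry of \<open>A\<close> the transposed inverse is a left inverse of
  \<open>A\<close>, and a left inverse agrees with the right inverse.\<close>

lemma transpose_matrix_inv:
  fixes A :: "real^'n^'n"
  assumes "invertible A" "transpose A = A"
  shows "transpose (matrix_inv A) = matrix_inv A"
proof -
  have "transpose (matrix_inv A) = transpose (matrix_inv A) ** (A ** matrix_inv A)"
    using assms(1) by (simp add: matrix_inv_right)
  also have "\<dots> = transpose (A ** matrix_inv A) ** matrix_inv A"
    using assms(2) by (simp add: matrix_mul_assoc matrix_transpose_mul)
  also have "\<dots> = matrix_inv A"
    using assms(1) by (simp add: matrix_inv_right)
  finally show ?thesis .
qed

text \<open>\<open>W\<close> is the coefficient matrix of the best linear predictor of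
  \<open>X\<close> from \<open>Y\<close>: the cross moment of \<open>X\<close> with \<open>Y\<close>
  times the inverse second moment of \<open>Y\<close>. The covariance of \<open>X\<close> exceeds
  \<open>W ** H\<close> by exactly the second moment of the prediction error.\<close>

lemma cov_matrix_eq_iff_AE_affine:
  fixes X Y :: "'a \<Rightarrow> real^'q"
  assumes "prob_space M"
    and X: "finite_second_moments M X" "(\<integral>y. X y \<partial>M) = 0"
    and Y: "finite_second_moments M Y" "(\<integral>y. Y y \<partial>M) = 0"
    and H: "(\<integral>y. outer (Y y) (X y) \<partial>M) = H" "transpose H = H"
    and inv: "invertible (cov_matrix M Y)"
  defines "W \<equiv> H ** matrix_inv (cov_matrix M Y)"
  shows "W ** H = cov_matrix M X \<longleftrightarrow> (\<exists>b. AE y in M. X y = W *v Y y + b)"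
proof -
  interpret prob_space M by fact
  define Z where "Z y = X y - W *v Y y" for y
  have intX: "integrable M X" and intY: "integrable M Y"
    using X Y \<open>prob_space M\<close> by (auto intro: finite_second_moments_integrable)
  have intWY: "integrable M (\<lambda>y. W *v Y y)"
    by (rule integrable_bounded_linear[OF matrix_vector_mul_bounded_linear intY])
  have meanZ: "(\<integral>y. Z y \<partial>M) = 0"
    unfolding Z_def using intX intWY X Y
    by (simp add: integral_bounded_linear[OF matrix_vector_mul_bounded_linear intY])
  have trW: "transpose W = matrix_inv (cov_matrix M Y) ** H"
    by (simp add: W_def matrix_transpose_mul H(2) transpose_matrix_inv inv transpose_cov_matrix)
  have WH: "transpose (W ** H) = W ** H"
    by (simp add: matrix_transpose_mul trW H(2)) (simp add: W_def matrix_mul_assoc)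
  \<comment> \<open>This cancels the inverse in the quadratic term, which thereby becomes
    \<open>W ** H\<close> and offsets one of the two mixed terms.\<close>
  have "W ** cov_matrix M Y = H"
    using inv by (simp add: W_def matrix_mul_assoc[symmetric] matrix_inv_left)
  then have "W ** cov_matrix M Y ** transpose W = W ** H"
    by (simp add: trW) (simp add: W_def matrix_mul_assoc)
  then have res: "(\<integral>y. outer (Z y) (Z y) \<partial>M) = cov_matrix M X - W ** H"
    using integral_outer_residual(2)[OF X(1) Y(1), of W]
    by (simp add: Z_def H WH cov_matrix_eq_integral_outer X Y intX intY)
  have "(W ** H = cov_matrix M X) = (AE y in M. Z y = 0)"
    using AE_eq_0_iff_integral_outer[OF integral_outer_residual(1)[OF X(1) Y(1), of W]] res
    by (auto simp: Z_def)
  also have "\<dots> = (\<exists>b. AE y in M. X y = W *v Y y + b)"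
  proof
    assume "AE y in M. Z y = 0"
    then have "AE y in M. X y = W *v Y y + 0"
      by eventually_elim (simp add: Z_def)
    then show "\<exists>b. AE y in M. X y = W *v Y y + b" ..
  next
    assume "\<exists>b. AE y in M. X y = W *v Y y + b"
    then obtain b where "AE y in M. X y = W *v Y y + b" ..
    then have b: "AE y in M. Z y = b"
      by eventually_elim (simp add: Z_def)
    \<comment> \<open>An almost surely constant residual equals its own mean, which is zero;
      measurability allows the two integrals to be compared.\<close>
    have "Z \<in> borel_measurable M"
      unfolding Z_def[abs_def] using intX intWY by (intro borel_measurable_diff) auto
    then have "(\<integral>y. Z y \<partial>M) = (\<integral>y. b \<partial>M)"
      using b by (intro integral_cong_AE) auto
    then have "b = 0" by (simp add: meanZ prob_space)
    with b show "AE y in M. Z y = 0" by simp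
  qed
  finally show ?thesis .
qed

subsection \<open>The second Bartlett identity\<close>

lemma jacobian_eqI:
  fixes A :: "real^'n^'m"
  assumes "(F has_derivative (\<lambda>h. A *v h)) (at x)"
  shows "jacobian F (at x) = A"
  using assms frechet_derivative_at[of F "\<lambda>h. A *v h" x, symmetric] by (simp add: jacobian_def)

text \<open>This is the product rule: the gradient of the density is the density times its score, so
  the density factors out of both terms.\<close>

lemma jacobian_density_scaleR_score:
  fixes f :: "real^'q \<Rightarrow> real^'p \<Rightarrow> real"
  assumes \<Theta>: "open \<Theta>" "\<theta> \<in> \<Theta>"
    and nonneg: "\<And>t. t \<in> \<Theta> \<Longrightarrow> 0 \<le> f t y"
    and supp: "\<And>t. t \<in> \<Theta> \<Longrightarrow> 0 < f t y \<longleftrightarrow> 0 < f \<theta> y"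
    and f: "0 < f \<theta> y \<Longrightarrow> C2_on \<Theta> (\<lambda>t. ln (f t y))"
    and c: "0 < f \<theta> y \<Longrightarrow> C2_on \<Theta> (\<lambda>t. ln (c t y))"
  shows "jacobian (\<lambda>t. f t y *\<^sub>R score c t y) (at \<theta>)
           = f \<theta> y *\<^sub>R (outer (score c \<theta> y) (score f \<theta> y) + jacobian (\<lambda>t. score c t y) (at \<theta>))"
proof (rule jacobian_eqI, cases "0 < f \<theta> y")
  case True
  define A where "A = jacobian (\<lambda>t. score c t y) (at \<theta>)"
  have "((\<lambda>t. ln (f t y)) has_derivative (\<lambda>h. score f \<theta> y \<bullet> h)) (at \<theta>)"
    unfolding score_def using f[OF True] \<Theta> by (intro has_derivative_grad) (auto simp: C2_on_def)
  \<comment> \<open>Differentiability is assumed of the log density, so the density is recovered as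
    its exponential. The two agree on all of \<open>\<Theta>\<close> because the support is
    common.\<close>
  then have "((\<lambda>t. exp (ln (f t y))) has_derivative (\<lambda>h. f \<theta> y * (score f \<theta> y \<bullet> h))) (at \<theta>)"
    by (rule has_derivative_eq_rhs[OF has_derivative_exp]) (use True in \<open>simp add: mult.commute\<close>)
  then have 1: "((\<lambda>t. f t y) has_derivative (\<lambda>h. f \<theta> y * (score f \<theta> y \<bullet> h))) (at \<theta>)"
    by (rule has_derivative_transform_within_open[OF _ \<Theta>]) (use supp True in auto)
  have 2: "((\<lambda>t. score c t y) has_derivative (\<lambda>h. A *v h)) (at \<theta>)"
    unfolding A_def using c[OF True] \<Theta>(2) by (subst jacobian_works[symmetric]) (auto simp: C2_on_def score_def)
  show "((\<lambda>t. f t y *\<^sub>R score c t y) has_derivative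
      (\<lambda>h. (f \<theta> y *\<^sub>R (outer (score c \<theta> y) (score f \<theta> y) + A)) *v h)) (at \<theta>)"
    by (rule has_derivative_eq_rhs[OF has_derivative_scaleR[OF 1 2]])
      (simp add: fun_eq_iff scaleR_matrix_vector_assoc[symmetric]
        outer_mult_vec algebra_simps)
next
  \<comment> \<open>A density that vanishes at \<theta> vanishes on all of \<open>\<Theta>\<close>,
    so both sides are zero whatever values the scores and the Jacobian take at this
    \<open>y\<close>.\<close>
  case False
  then have 0: "f t y = 0" if "t \<in> \<Theta>" for t
    using nonneg[OF that] supp[OF that] by auto
  have "((\<lambda>t. f t y *\<^sub>R score c t y) has_derivative (\<lambda>h. 0)) (at \<theta>)"
    by (rule has_derivative_transform_within_open[OF has_derivative_const \<Theta>]) (simp add: 0)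
  then show "((\<lambda>t. f t y *\<^sub>R score c t y) has_derivative
      (\<lambda>h. (f \<theta> y *\<^sub>R (outer (score c \<theta> y) (score f \<theta> y) + jacobian (\<lambda>t. score c t y) (at \<theta>))) *v h)) (at \<theta>)"
    by (simp add: 0[OF \<Theta>(2)])
qed

lemma integral_law:
  fixes X :: "real^'p \<Rightarrow> 'b::{banach, second_countable_topology}"
  assumes "f \<theta> \<in> borel_measurable \<mu>" "\<And>y. 0 \<le> f \<theta> y" "X \<in> borel_measurable (law \<mu> f \<theta>)"
  shows "(\<integral>y. X y \<partial>law \<mu> f \<theta>) = (\<integral>y. f \<theta> y *\<^sub>R X y \<partial>\<mu>)"
  using assms unfolding law_def by (intro integral_density) (auto cong: measurable_cong_sets)

text \<open>The mean-zero identity makes the \<open>\<mu>\<close>-integral of density times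
  composite score vanish throughout \<open>\<Theta>\<close>. Its derivative is therefore zero, and
  by the product rule it equals the cross moment plus the mean Jacobian, which is minus the
  sensitivity.\<close>

lemma sensitivity_matrix_eq_cross_moment:
  fixes f :: "real^'q \<Rightarrow> real^'p \<Rightarrow> real"
  assumes \<Theta>: "open \<Theta>" "\<theta> \<in> \<Theta>"
    and meas: "\<And>t. t \<in> \<Theta> \<Longrightarrow> f t \<in> borel_measurable \<mu>"
    and nonneg: "\<And>t y. t \<in> \<Theta> \<Longrightarrow> 0 \<le> f t y"
    and supp: "\<And>t y. t \<in> \<Theta> \<Longrightarrow> 0 < f t y \<longleftrightarrow> 0 < f \<theta> y"
    and f: "\<And>y. 0 < f \<theta> y \<Longrightarrow> C2_on \<Theta> (\<lambda>t. ln (f t y))"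
    and c: "\<And>y. 0 < f \<theta> y \<Longrightarrow> C2_on \<Theta> (\<lambda>t. ln (c t y))"
    and momf: "finite_second_moments (law \<mu> f \<theta>) (score f \<theta>)"
    and momc: "\<And>t. t \<in> \<Theta> \<Longrightarrow> finite_second_moments (law \<mu> f t) (score c t)"
    and jac: "integrable (law \<mu> f \<theta>) (\<lambda>y. jacobian (\<lambda>t. score c t y) (at \<theta>))"
    and mean: "\<And>t. t \<in> \<Theta> \<Longrightarrow> (\<integral>y. score c t y \<partial>law \<mu> f t) = 0"
    and diff: "((\<lambda>t. \<integral>y. f t y *\<^sub>R score c t y \<partial>\<mu>) has_derivative
           (\<lambda>h. (\<integral>y. jacobian (\<lambda>t. f t y *\<^sub>R score c t y) (at \<theta>) \<partial>\<mu>) *v h)) (at \<theta>)"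
  shows "sensitivity_matrix (law \<mu> f) c \<theta> = (\<integral>y. outer (score c \<theta> y) (score f \<theta> y) \<partial>law \<mu> f \<theta>)"
proof -
  let ?A = "\<lambda>y. jacobian (\<lambda>t. score c t y) (at \<theta>)"
  let ?O = "\<lambda>y. outer (score c \<theta> y) (score f \<theta> y)"
  have int: "integrable (law \<mu> f \<theta>) ?O"
    using momc[OF \<Theta>(2)] momf by (rule integrable_outer)
  have zero: "(\<integral>y. f t y *\<^sub>R score c t y \<partial>\<mu>) = 0" if "t \<in> \<Theta>" for t
    using integral_law[of f t \<mu> "score c t"] that meas nonneg mean momc
    by (simp add: finite_second_moments_def)
  \<comment> \<open>The integral is known to vanish only on \<open>\<Theta>\<close>; as
    \<open>\<Theta>\<close> is open, this determines the derivative at \<theta>.\<close>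
  have "((\<lambda>t. \<integral>y. f t y *\<^sub>R score c t y \<partial>\<mu>) has_derivative (\<lambda>h. 0 *v h)) (at \<theta>)"
    by (simp, rule has_derivative_transform_within_open[OF has_derivative_const \<Theta>])
      (simp add: zero)
  then have "0 = jacobian (\<lambda>t. \<integral>y. f t y *\<^sub>R score c t y \<partial>\<mu>) (at \<theta>)"
    by (rule jacobian_eqI[symmetric])
  also have "\<dots> = (\<integral>y. jacobian (\<lambda>t. f t y *\<^sub>R score c t y) (at \<theta>) \<partial>\<mu>)"
    using diff by (rule jacobian_eqI)
  also have "\<dots> = (\<integral>y. f \<theta> y *\<^sub>R (?O y + ?A y) \<partial>\<mu>)"
    by (intro Bochner_Integration.integral_cong refl jacobian_density_scaleR_score[OF \<Theta>] nonneg supp f c)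
      assumption+
  also have "\<dots> = (\<integral>y. ?O y + ?A y \<partial>law \<mu> f \<theta>)"
    using int jac meas nonneg \<Theta>(2) by (intro integral_law[symmetric]) auto
  also have "\<dots> = (\<integral>y. ?O y \<partial>law \<mu> f \<theta>) + (\<integral>y. ?A y \<partial>law \<mu> f \<theta>)"
    using int jac by simp
  finally show ?thesis
    using jac by (simp add: sensitivity_matrix_def neg_eq_iff_add_eq_0 add.commute)
qed

text \<open>The Hessian is symmetric at every \<open>y\<close> in the support, and the complement of
  the support is a null set of the law; transposition then commutes with the integral.\<close>

lemma transpose_sensitivity_matrix:
  fixes f :: "real^'q \<Rightarrow> real^'p \<Rightarrow> real"
  assumes \<Theta>: "open \<Theta>" "\<theta> \<in> \<Theta>"
    and meas: "f \<theta> \<in> borel_measurable \<mu>"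
    and c: "\<And>y. 0 < f \<theta> y \<Longrightarrow> C2_on \<Theta> (\<lambda>t. ln (c t y))"
    and jac: "integrable (law \<mu> f \<theta>) (\<lambda>y. jacobian (\<lambda>t. score c t y) (at \<theta>))"
  shows "transpose (sensitivity_matrix (law \<mu> f) c \<theta>) = sensitivity_matrix (law \<mu> f) c \<theta>"
proof -
  let ?A = "\<lambda>y. - jacobian (\<lambda>t. score c t y) (at \<theta>)"
  have int: "integrable (law \<mu> f \<theta>) ?A" using jac by simp
  note intT = integrable_bounded_linear[OF bounded_linear_transpose int]
  have "transpose (?A y) = ?A y" if "0 < f \<theta> y" for y
    using transpose_jacobian_grad[OF \<Theta> c[OF that]]
    by (simp add: score_def transpose_def vec_eq_iff)
  then have "AE y in law \<mu> f \<theta>. transpose (?A y) = ?A y"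
    unfolding law_def using meas by (subst AE_density) auto
  then have "(\<integral>y. transpose (?A y) \<partial>law \<mu> f \<theta>) = (\<integral>y. ?A y \<partial>law \<mu> f \<theta>)"
    using int intT by (intro integral_cong_AE) auto
  then show ?thesis
    unfolding sensitivity_matrix_def by (simp only: integral_bounded_linear[OF bounded_linear_transpose int])
qed

section \<open>The criterion for the full and the composite score\<close>

theorem theorem1:
  fixes \<Theta> :: "(real^'q) set"
    and \<mu> :: "(real^'p) measure"
    and f :: "real^'q \<Rightarrow> real^'p \<Rightarrow> real"
    and K :: nat and w :: "nat \<Rightarrow> real"
    and L :: "nat \<Rightarrow> real^'q \<Rightarrow> real^'p \<Rightarrow> real"
  defines "P \<equiv> law \<mu> f"
    and "CL \<equiv> composite_likelihood K w L"
  defines "u \<equiv> score f"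
    and "u\<^sub>c \<equiv> score CL"
    and "I \<equiv> fisher_information P f"
    and "H \<equiv> sensitivity_matrix P CL"
    and "J \<equiv> variability_matrix P CL"
    and "G \<equiv> godambe_information P CL"
  assumes "open \<Theta>"
    and "sets \<mu> = sets borel"
    and "\<And>\<theta>. \<theta> \<in> \<Theta> \<Longrightarrow> f \<theta> \<in> borel_measurable \<mu>"
    and "\<And>\<theta> y. \<theta> \<in> \<Theta> \<Longrightarrow> 0 \<le> f \<theta> y"
    and "\<And>\<theta>. \<theta> \<in> \<Theta> \<Longrightarrow> prob_space (P \<theta>)"
    and "\<And>k. k \<in> {1..K} \<Longrightarrow> 0 \<le> w k"
    and "\<And>k. k \<in> {1..K} \<Longrightarrow> component_likelihood \<mu> f \<Theta> (L k)"
    and "\<And>\<theta> \<theta>'. \<theta> \<in> \<Theta> \<Longrightarrow> \<theta>' \<in> \<Theta> \<Longrightarrow> {y. 0 < f \<theta> y} = {y. 0 < f \<theta>' y}"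
    and "\<And>\<theta> y. \<theta> \<in> \<Theta> \<Longrightarrow> 0 < f \<theta> y \<Longrightarrow> 0 < CL \<theta> y"
    and "\<And>\<theta> y. \<theta> \<in> \<Theta> \<Longrightarrow> 0 < f \<theta> y \<Longrightarrow> C2_on \<Theta> (\<lambda>t. ln (f t y))"
    and "\<And>\<theta> y. \<theta> \<in> \<Theta> \<Longrightarrow> 0 < f \<theta> y \<Longrightarrow> C2_on \<Theta> (\<lambda>t. ln (CL t y))"
    and "\<And>\<theta>. \<theta> \<in> \<Theta> \<Longrightarrow> finite_second_moments (P \<theta>) (u \<theta>)"
    and "\<And>\<theta>. \<theta> \<in> \<Theta> \<Longrightarrow> finite_second_moments (P \<theta>) (u\<^sub>c \<theta>)"
    and "\<And>\<theta>. \<theta> \<in> \<Theta> \<Longrightarrow> integrable (P \<theta>) (\<lambda>y. jacobian (\<lambda>t. u\<^sub>c t y) (at \<theta>))"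
    and "\<And>\<theta>. \<theta> \<in> \<Theta> \<Longrightarrow> (\<integral>y. u \<theta> y \<partial>P \<theta>) = 0"
    and "\<And>\<theta>. \<theta> \<in> \<Theta> \<Longrightarrow> (\<integral>y. u\<^sub>c \<theta> y \<partial>P \<theta>) = 0"
    and "\<And>\<theta>. \<theta> \<in> \<Theta> \<Longrightarrow>
          ((\<lambda>t. \<integral>y. f t y *\<^sub>R u\<^sub>c t y \<partial>\<mu>) has_derivative
           (\<lambda>h. (\<integral>y. jacobian (\<lambda>t. f t y *\<^sub>R u\<^sub>c t y) (at \<theta>) \<partial>\<mu>) *v h)) (at \<theta>)"
    and "\<And>\<theta>. \<theta> \<in> \<Theta> \<Longrightarrow> invertible (J \<theta>)"
  shows "\<forall>\<theta>\<in>\<Theta>. G \<theta> = I \<theta> \<longleftrightarrow>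
           (\<exists>b::real^'q. AE y in P \<theta>. u \<theta> y = (H \<theta> ** matrix_inv (J \<theta>)) *v u\<^sub>c \<theta> y + b)"
proof
  fix \<theta>
  assume \<theta>: "\<theta> \<in> \<Theta>"
  \<comment> \<open>The first eight members of \<open>assms\<close> are the defining equations, so
    \<open>asm(n)\<close> is \<open>assms(n+8)\<close> in unfolded form.\<close>
  note asm = assms(9-)[unfolded P_def u_def u\<^sub>c_def]
  have supp: "0 < f t y \<longleftrightarrow> 0 < f \<theta> y" if "t \<in> \<Theta>" for t y
    using asm(8)[OF that \<theta>] by (metis mem_Collect_eq)
  have "(\<integral>y. outer (u\<^sub>c \<theta> y) (u \<theta> y) \<partial>P \<theta>) = H \<theta>"
    unfolding P_def u_def u\<^sub>c_def H_def
    by (rule sensitivity_matrix_eq_cross_moment[symmetric, OF asm(1) \<theta> asm(3,4) supp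
          asm(10)[OF \<theta>] asm(11)[OF \<theta>] asm(12)[OF \<theta>] asm(13) asm(14)[OF \<theta>] asm(16) asm(17)[OF \<theta>]])
  moreover have "transpose (H \<theta>) = H \<theta>"
    unfolding P_def H_def
    by (rule transpose_sensitivity_matrix[OF asm(1) \<theta> asm(3)[OF \<theta>] asm(11)[OF \<theta>] asm(14)[OF \<theta>]])
  moreover have J: "J \<theta> = cov_matrix (P \<theta>) (u\<^sub>c \<theta>)" and "I \<theta> = cov_matrix (P \<theta>) (u \<theta>)"
    by (simp_all only: J_def I_def u_def u\<^sub>c_def variability_matrix_def fisher_information_def)
  moreover have "G \<theta> = H \<theta> ** matrix_inv (J \<theta>) ** H \<theta>"
    by (simp only: G_def H_def J_def godambe_information_def)
  moreover have "invertible (cov_matrix (P \<theta>) (u\<^sub>c \<theta>))"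
    using assms(26)[OF \<theta>] by (simp only: J)
  ultimately show "G \<theta> = I \<theta> \<longleftrightarrow>
      (\<exists>b::real^'q. AE y in P \<theta>. u \<theta> y = (H \<theta> ** matrix_inv (J \<theta>)) *v u\<^sub>c \<theta> y + b)"
    \<comment> \<open>The moment criterion is applied with the full score as \<open>X\<close> and
      the composite score as \<open>Y\<close>; its matrix \<open>W ** H\<close> is then the Godambe
      information.\<close>
    using cov_matrix_eq_iff_AE_affine[OF assms(13)[OF \<theta>] assms(20)[OF \<theta>] assms(23)[OF \<theta>]
        assms(21)[OF \<theta>] assms(24)[OF \<theta>]] by simp
qed

end
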